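(* Every Alpay Algebra $\mathcal{A}$ inherently defines a small category (in fact, a directed acyclic graph of state transitions, possibly with loops if adjustments permit reversal). In particular, consider the relation of reachability on the states $X$: for $x,y\in X$, say $x\to y$ if there exists an adjustment $a\in A$ such that $x+a=y$. Then by closing this relation under composition, we obtain a category $\mathcal{C}_{\mathcal{A}}$ where: (i) Objects are the states $X$. (ii) For any two states $x,y\in X$, the morphisms $\hom(x,y)$ consist of all (finite) sequences of adjustments $a_1,a_2,\ldots,a_n\in A$ such that $y = x+(a_1+a_2+\cdots+a_n)$. In particular, each single-step adjustment $a : x\to x+a$ is a morphism, and longer morphisms are formal composites of these. (iii) Composition of morphisms corresponds to concatenation of sequences (or equivalently addition of the corresponding adjustments, using monoid associativity). Identities are given by the empty sequence (or $0$ adjustment) at each state.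
   Context: An Alpay Algebra $\mathcal{A}$ consists of: a class (or set) $X$ of states, with no assumption that $X$ is a set in the ZF sense; a set (or class) $A$ of adjustments with a distinguished neutral adjustment $0\in A$ and an addition $+$ on $A$; a state update operation $+ : X\times A\to X$; an update rule $\phi : X\to A$; a totally ordered set (or class) $(E,\le)$, possibly extended with a top element $\top$; and an evaluation function $\Psi : X\to E$. These satisfy the following axioms. (1) $(A,+,0)$ is a commutative monoid. (2) $x+0=x$ and $(x+a)+b = x+(a+b)$ for all $x\in X$, $a,b\in A$. (3) $\phi(x)\in A$ is a uniquely defined adjustment for every $x\in X$. (4) For every $x\in X$: if $\phi(x)\neq 0$ then $\Psi(x) < \Psi(x+\phi(x))$; if $\phi(x)=0$ then $\Psi(x+a)\le\Psi(x)$ for all $a\in A$. (5) A state $x$ with $\phi(x)=0$ is called a fixed point. If $\Psi(x)$ is a maximal element of $\Psi(X)\subseteq E$, then $\phi(x)=0$. Optionally, some state $x_0\in X$ is designated as an initial state. *)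

theory Defs
  imports "HOL-Algebra.Group"
begin

section \<open>Alpay algebras\<close>

text \<open>
  The commutative monoid of adjustments is a HOL-Algebra monoid, so its addition and its neutral
  adjustment are written \<open>\<otimes>\<close> and \<open>\<one>\<close>.  The state update \<open>x + a\<close> is \<open>act x a\<close>.  The evaluation
  domain is a carrier set \<open>E\<close> with a total order \<open>leE\<close> given as a relation; a top element, if
  present, is just an element of \<open>E\<close>.  The initial state is optional.
\<close>

locale alpay_algebra = comm_monoid A for A (structure) +
  fixes X :: "'x set"
    and act :: "'x \<Rightarrow> 'a \<Rightarrow> 'x"
    and \<phi> :: "'x \<Rightarrow> 'a"
    and E :: "'e set"
    and leE :: "'e rel"
    and \<Psi> :: "'x \<Rightarrow> 'e"
    and init :: "'x option"
  assumes act_closed: "\<lbrakk>x \<in> X; a \<in> carrier A\<rbrakk> \<Longrightarrow> act x a \<in> X"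
    and linear_E: "linear_order_on E leE"
    and eval_closed: "x \<in> X \<Longrightarrow> \<Psi> x \<in> E"
    and init_state: "init = Some x \<Longrightarrow> x \<in> X"
    and act_neutral: "x \<in> X \<Longrightarrow> act x \<one> = x"
    and act_assoc: "\<lbrakk>x \<in> X; a \<in> carrier A; b \<in> carrier A\<rbrakk>
          \<Longrightarrow> act (act x a) b = act x (a \<otimes> b)"
    and rule_closed: "x \<in> X \<Longrightarrow> \<phi> x \<in> carrier A"
    and eval_increases: "\<lbrakk>x \<in> X; \<phi> x \<noteq> \<one>\<rbrakk>
          \<Longrightarrow> (\<Psi> x, \<Psi> (act x (\<phi> x))) \<in> leE \<and> \<Psi> x \<noteq> \<Psi> (act x (\<phi> x))"
    and eval_stable: "\<lbrakk>x \<in> X; \<phi> x = \<one>; a \<in> carrier A\<rbrakk> \<Longrightarrow> (\<Psi> (act x a), \<Psi> x) \<in> leE"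
    and maximal_fixed: "\<lbrakk>x \<in> X; \<forall>e \<in> \<Psi> ` X. (\<Psi> x, e) \<in> leE \<longrightarrow> e = \<Psi> x\<rbrakk> \<Longrightarrow> \<phi> x = \<one>"


section \<open>Small categories and functors\<close>

text \<open>
  Categories are presented by hom-sets indexed by pairs of objects.  Hom-sets of different pairs
  need not be disjoint: a morphism is understood together with its source and target, which is why
  identities and composition take the objects as arguments.  \<open>Comp C x y z g f\<close> is the composite
  of \<open>f : x \<rightarrow> y\<close> followed by \<open>g : y \<rightarrow> z\<close>.
\<close>

record ('o, 'm) precategory =
  Obj :: "'o set"
  Hom :: "'o \<Rightarrow> 'o \<Rightarrow> 'm set"
  Ident :: "'o \<Rightarrow> 'm"
  Comp :: "'o \<Rightarrow> 'o \<Rightarrow> 'o \<Rightarrow> 'm \<Rightarrow> 'm \<Rightarrow> 'm"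

locale small_category =
  fixes C :: "('o, 'm) precategory"
  assumes Ident_in_Hom: "x \<in> Obj C \<Longrightarrow> Ident C x \<in> Hom C x x"
    and Comp_in_Hom: "\<lbrakk>x \<in> Obj C; y \<in> Obj C; z \<in> Obj C; f \<in> Hom C x y; g \<in> Hom C y z\<rbrakk>
          \<Longrightarrow> Comp C x y z g f \<in> Hom C x z"
    and Comp_Ident_right: "\<lbrakk>x \<in> Obj C; y \<in> Obj C; f \<in> Hom C x y\<rbrakk> \<Longrightarrow> Comp C x x y f (Ident C x) = f"
    and Comp_Ident_left: "\<lbrakk>x \<in> Obj C; y \<in> Obj C; f \<in> Hom C x y\<rbrakk> \<Longrightarrow> Comp C x y y (Ident C y) f = f"
    and Comp_assoc: "\<lbrakk>w \<in> Obj C; x \<in> Obj C; y \<in> Obj C; z \<in> Obj C;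
            f \<in> Hom C w x; g \<in> Hom C x y; h \<in> Hom C y z\<rbrakk>
          \<Longrightarrow> Comp C w x z (Comp C x y z h g) f = Comp C w y z h (Comp C w x y g f)"

locale small_functor = C: small_category C + D: small_category D
  for C :: "('o, 'm) precategory" and D :: "('p, 'n) precategory" +
  fixes Fo :: "'o \<Rightarrow> 'p" and Fm :: "'o \<Rightarrow> 'o \<Rightarrow> 'm \<Rightarrow> 'n"
  assumes Fo_Obj: "x \<in> Obj C \<Longrightarrow> Fo x \<in> Obj D"
    and Fm_Hom: "\<lbrakk>x \<in> Obj C; y \<in> Obj C; f \<in> Hom C x y\<rbrakk> \<Longrightarrow> Fm x y f \<in> Hom D (Fo x) (Fo y)"
    and Fm_Ident: "x \<in> Obj C \<Longrightarrow> Fm x x (Ident C x) = Ident D (Fo x)"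
    and Fm_Comp: "\<lbrakk>x \<in> Obj C; y \<in> Obj C; z \<in> Obj C; f \<in> Hom C x y; g \<in> Hom C y z\<rbrakk>
          \<Longrightarrow> Fm x z (Comp C x y z g f) = Comp D (Fo x) (Fo y) (Fo z) (Fm y z g) (Fm x y f)"


section \<open>State transitions\<close>

definition transition :: "('a, 'b) monoid_scheme \<Rightarrow> 'x set \<Rightarrow> ('x \<Rightarrow> 'a \<Rightarrow> 'x) \<Rightarrow> 'x rel" where
  "transition A X act = {(x, y). x \<in> X \<and> y \<in> X \<and> (\<exists>a \<in> carrier A. act x a = y)}"

text \<open>Adjustments permit reversal if some adjustment that really changes a state can be undone.\<close>

definition permits_reversal :: "('a, 'b) monoid_scheme \<Rightarrow> 'x set \<Rightarrow> ('x \<Rightarrow> 'a \<Rightarrow> 'x) \<Rightarrow> bool" where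
  "permits_reversal A X act \<longleftrightarrow>
     (\<exists>x \<in> X. \<exists>a \<in> carrier A. \<exists>b \<in> carrier A. act x a \<noteq> x \<and> act (act x a) b = x)"

definition total_adj :: "('a, 'b) monoid_scheme \<Rightarrow> 'a list \<Rightarrow> 'a" where
  "total_adj A as = foldr (\<otimes>\<^bsub>A\<^esub>) as \<one>\<^bsub>A\<^esub>"

text \<open>Sequences are listed in the order in which the adjustments are applied.\<close>

definition state_category ::
  "('a, 'b) monoid_scheme \<Rightarrow> 'x set \<Rightarrow> ('x \<Rightarrow> 'a \<Rightarrow> 'x) \<Rightarrow> ('x, 'a list) precategory" where
  "state_category A X act = \<lparr>
     Obj = X,
     Hom = (\<lambda>x y. {as. set as \<subseteq> carrier A \<and> y = act x (total_adj A as)}),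
     Ident = (\<lambda>x. []),
     Comp = (\<lambda>x y z g f. f @ g)\<rparr>"

text \<open>The variant in which composition is addition and identities are the neutral adjustment.\<close>

definition additive_state_category ::
  "('a, 'b) monoid_scheme \<Rightarrow> 'x set \<Rightarrow> ('x \<Rightarrow> 'a \<Rightarrow> 'x) \<Rightarrow> ('x, 'a) precategory" where
  "additive_state_category A X act = \<lparr>
     Obj = X,
     Hom = (\<lambda>x y. {a \<in> carrier A. y = act x a}),
     Ident = (\<lambda>x. \<one>\<^bsub>A\<^esub>),
     Comp = (\<lambda>x y z b a. a \<otimes>\<^bsub>A\<^esub> b)\<rparr>"

text \<open>
  The composite, formed in the category of states, of the single-step morphisms
  \<open>[a\<^sub>1] : x \<rightarrow> x + a\<^sub>1\<close>, \<open>[a\<^sub>2] : x + a\<^sub>1 \<rightarrow> (x + a\<^sub>1) + a\<^sub>2\<close>, and so on.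
\<close>

fun steps_composite ::
  "('a, 'b) monoid_scheme \<Rightarrow> 'x set \<Rightarrow> ('x \<Rightarrow> 'a \<Rightarrow> 'x) \<Rightarrow> 'x \<Rightarrow> 'a list \<Rightarrow> 'a list" where
  "steps_composite A X act x [] = Ident (state_category A X act) x"
| "steps_composite A X act x (a # as) =
     Comp (state_category A X act) x (act x a) (act (act x a) (total_adj A as))
       (steps_composite A X act (act x a) as) [a]"

end

theory Submission
  imports Defs
begin

text \<open>
  Since \<open>(x + a) + b = x + (a + b)\<close>, reachability in one step is already transitive.
  Hence a cycle of proper transitions collapses to a step \<open>x \<rightarrow> y\<close> with \<open>x \<noteq> y\<close> followed by a single
  adjustment from \<open>y\<close> back to \<open>x\<close>, which is exactly a reversal.  The category laws are those of list
  concatenation, and summing a list is a monoid homomorphism into the adjustments.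
\<close>

lemma total_adj_Nil [simp]: "total_adj A [] = \<one>\<^bsub>A\<^esub>"
  and total_adj_Cons [simp]: "total_adj A (a # as) = a \<otimes>\<^bsub>A\<^esub> total_adj A as"
  by (simp_all add: total_adj_def)

lemma (in monoid) total_adj_closed [simp]:
  "set as \<subseteq> carrier G \<Longrightarrow> total_adj G as \<in> carrier G"
  by (induction as) auto

lemma (in monoid) total_adj_append:
  "\<lbrakk>set as \<subseteq> carrier G; set bs \<subseteq> carrier G\<rbrakk>
    \<Longrightarrow> total_adj G (as @ bs) = total_adj G as \<otimes> total_adj G bs"
  by (induction as) (auto simp: m_assoc)

text \<open>\<open>Comp\<close> puts the earlier morphism first, so each recursion step conses its
  single step back onto the list.\<close>

lemma steps_composite_eq: "steps_composite A X act x as = as"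
  by (induction as arbitrary: x) (simp_all add: state_category_def)

context alpay_algebra
begin

lemma total_adj_single: "a \<in> carrier A \<Longrightarrow> total_adj A [a] = a"
  by simp

lemma trans_transition: "trans (transition A X act)"
proof (rule transI)
  fix x y z
  assume "(x, y) \<in> transition A X act" "(y, z) \<in> transition A X act"
  then obtain a b where "x \<in> X" "z \<in> X" "a \<in> carrier A" "b \<in> carrier A" "act (act x a) b = z"
    by (auto simp: transition_def)
  then show "(x, z) \<in> transition A X act"
    using act_assoc by (auto simp: transition_def)
qed

text \<open>The neutral adjustment gives every state a loop, hence the removal of
  \<open>Id\<close>.\<close>

lemma acyclic_transition_iff:
  "acyclic (transition A X act - Id) \<longleftrightarrow> \<not> permits_reversal A X act"
proof
  assume ac: "acyclic (transition A X act - Id)"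
  show "\<not> permits_reversal A X act"
  proof
    assume "permits_reversal A X act"
    then obtain x a b where "x \<in> X" "a \<in> carrier A" "b \<in> carrier A"
      "act x a \<noteq> x" "act (act x a) b = x"
      by (auto simp: permits_reversal_def)
    then have "(x, act x a) \<in> transition A X act - Id" "(act x a, x) \<in> transition A X act - Id"
      using act_closed by (auto simp: transition_def)
    then have "(x, x) \<in> (transition A X act - Id)\<^sup>+"
      by (meson trancl.simps)
    with ac show False
      by (simp add: acyclic_def)
  qed
next
  assume no_rev: "\<not> permits_reversal A X act"
  show "acyclic (transition A X act - Id)"
  proof (rule acyclicI, intro allI notI)
    fix x
    assume "(x, x) \<in> (transition A X act - Id)\<^sup>+"
    then obtain y where xy: "(x, y) \<in> transition A X act - Id"
      and "(y, x) \<in> (transition A X act - Id)\<^sup>*"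
      by (meson tranclD)
    \<comment> \<open>Only the first edge has to stay proper; the rest of the cycle may contain
      loops.\<close>
    then have "(y, x) \<in> (transition A X act)\<^sup>*"
      by (meson Diff_subset in_mono rtrancl_mono)
    \<comment> \<open>The empty path is excluded by x \<noteq> y, and transitivity collapses any
      other path to one step.\<close>
    then have "(y, x) \<in> transition A X act"
      using xy trans_transition by (auto simp: rtrancl_eq_or_trancl)
    with xy no_rev show False
      by (auto simp: permits_reversal_def transition_def)
  qed
qed

text \<open>Fullness of the summing functor: an adjustment is the total of its own singleton
  sequence. It also reduces nonemptiness of hom-sets to one-step reachability.\<close>

lemma total_adj_image_Hom:
  "total_adj A ` Hom (state_category A X act) x y = Hom (additive_state_category A X act) x y"
proof
  show "total_adj A ` Hom (state_category A X act) x y \<subseteq> Hom (additive_state_category A X act) x y"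
    by (auto simp: state_category_def additive_state_category_def)
  show "Hom (additive_state_category A X act) x y \<subseteq> total_adj A ` Hom (state_category A X act) x y"
    by (auto simp: state_category_def additive_state_category_def total_adj_single
        simp del: total_adj_Cons intro!: rev_image_eqI[where x = "[_]"])
qed

lemma Hom_nonempty_iff:
  assumes "x \<in> X" "y \<in> X"
  shows "Hom (state_category A X act) x y \<noteq> {} \<longleftrightarrow> (x, y) \<in> (transition A X act)\<^sup>+"
proof -
  have "Hom (state_category A X act) x y \<noteq> {} \<longleftrightarrow> Hom (additive_state_category A X act) x y \<noteq> {}"
    unfolding total_adj_image_Hom [symmetric] by simp
  also have "\<dots> \<longleftrightarrow> (x, y) \<in> transition A X act"
    using assms by (auto simp: additive_state_category_def transition_def)
  finally show ?thesis
    using trans_transition by simp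
qed

text \<open>The action matters only for membership in hom-sets: \<open>act_neutral\<close> handles
  identities, and \<open>total_adj_append\<close> with \<open>act_assoc\<close> handles
  composites.\<close>

lemma small_category_state_category: "small_category (state_category A X act)"
  by unfold_locales
    (auto simp: state_category_def total_adj_append act_assoc act_neutral)

lemma small_category_additive_state_category: "small_category (additive_state_category A X act)"
  by unfold_locales
    (auto simp: additive_state_category_def act_assoc act_neutral m_assoc)

text \<open>This makes precise that concatenation corresponds to addition and the empty sequence to
  the neutral adjustment.\<close>

lemma small_functor_total_adj:
  "small_functor (state_category A X act) (additive_state_category A X act)
     (\<lambda>x. x) (\<lambda>x y. total_adj A)"
proof -
  interpret C: small_category "state_category A X act"
    by (rule small_category_state_category)
  interpret D: small_category "additive_state_category A X act"
    by (rule small_category_additive_state_category)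
  show ?thesis
    by unfold_locales
      (auto simp: state_category_def additive_state_category_def total_adj_append)
qed

end

theorem theorem3:
  fixes A :: "('a, 'b) monoid_scheme"
    and X :: "'x set"
    and act :: "'x \<Rightarrow> 'a \<Rightarrow> 'x"
    and \<phi> :: "'x \<Rightarrow> 'a"
    and E :: "'e set"
    and leE :: "'e rel"
    and \<Psi> :: "'x \<Rightarrow> 'e"
    and init :: "'x option"
  assumes "alpay_algebra A X act \<phi> E leE \<Psi> init"
  shows "let R = transition A X act;
             C = state_category A X act;
             D = additive_state_category A X act
         in
           small_category C \<and>
           (acyclic (R - Id) \<longleftrightarrow> \<not> permits_reversal A X act) \<and>
           (\<forall>x \<in> X. \<forall>y \<in> X. Hom C x y \<noteq> {} \<longleftrightarrow> (x, y) \<in> R\<^sup>+) \<and>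
           Obj C = X \<and>
           (\<forall>x \<in> X. \<forall>y \<in> X.
              Hom C x y = {as. set as \<subseteq> carrier A \<and> y = act x (total_adj A as)}) \<and>
           (\<forall>x \<in> X. \<forall>a \<in> carrier A. [a] \<in> Hom C x (act x a)) \<and>
           (\<forall>x \<in> X. \<forall>y \<in> X. \<forall>f \<in> Hom C x y. f = steps_composite A X act x f) \<and>
           (\<forall>x \<in> X. \<forall>y \<in> X. \<forall>z \<in> X. \<forall>f \<in> Hom C x y. \<forall>g \<in> Hom C y z.
              Comp C x y z g f = f @ g) \<and>
           (\<forall>x \<in> X. Ident C x = []) \<and>
           small_functor C D (\<lambda>x. x) (\<lambda>x y. total_adj A) \<and>
           (\<forall>x \<in> X. \<forall>y \<in> X. total_adj A ` Hom C x y = Hom D x y)"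
proof -
  interpret alpay_algebra A X act \<phi> E leE \<Psi> init
    by (rule assms)
  show ?thesis
    unfolding Let_def
    using small_category_state_category acyclic_transition_iff Hom_nonempty_iff
      small_functor_total_adj total_adj_image_Hom
    \<comment> \<open>The cited facts speak of the folded \<open>state_category\<close>; it is
      unfolded only afterwards, for the clauses that read off its fields.\<close>
    by (simp add: steps_composite_eq) (simp add: state_category_def)
qed

end
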